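(* Let $n\ge 1$ and let $K$ be a pure $n$-simplicial complex. Then $K$ is a simplicial tree if and only if $K$ has an $(n-1)$-complete ordering.
   Context: A simplicial complex $K$ on a finite vertex set is a collection of non-empty vertex subsets containing all singletons and closed under taking non-empty subsets; a $k$-simplex has $k+1$ vertices, and $\tau$ is a face of $\sigma$ if $\tau\subseteq\sigma$. $K^k$ is the set of $k$-simplices. $K$ is a pure $n$-simplicial complex if $\dim K=n$ and every simplex of $K$ is a face of some $n$-simplex of $K$. For a set $S$ of simplices, $\overline{S}$ (the closure) is the set of all faces of members of $S$. Let $0\le m\le n-1$. An $(m,n)$-walk sequence between $m$-simplices $\sigma,\sigma'$ is an alternating sequence $\sigma=\sigma_1,\eta_1,\sigma_2,\dots,\sigma_r,\eta_r,\sigma_{r+1}=\sigma'$ of $m$-simplices $\sigma_k$ and $n$-simplices $\eta_k$ of $K$ with $\sigma_k\ne\sigma_{k+1}$ and both faces of $\eta_k$ for $1\le k\le r$. It is an $(m,n)$-path sequence if all simplices in it are distinct. $K$ is connected if there is an $(n-1,n)$-path sequence between every pair of distinct $(n-1)$-simplices of $K$. An $(m,n)$-circuit sequence is an $(m,n)$-walk sequence with $\sigma_{r+1}=\sigma_1$ and $\sigma_p\neq\sigma_q$, $\eta_p\ne\eta_q$ for all $1\le p\ne q\le r$. It is an $(m,n)$-simplicial cycle sequence if moreover (i) $r\ge3$; (ii) $\sigma_1$ is not a face of $\eta_k$ for $2\le k\le r-1$; (iii) for each $2\le z\le r$ there is an $(n-1)$-simplex $\sigma'_z$ of $K$ which is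 a face of both $\eta_{z-1}$ and $\eta_z$ and has $\sigma_z$ as a face, with $\sigma'_x\ne\sigma'_y$ for $2\le x\ne y\le r$. $K$ is acyclic if it contains no $(m,n)$-simplicial cycle sequence for any $0\le m\le n-1$. A simplicial tree is a connected acyclic pure $n$-simplicial complex. For an $n$-simplex $\eta$ of a pure $n$-simplicial complex $L$, the attachment $\mathcal{A}(\eta,L)$ is the subcomplex of all faces $\sigma$ of $\eta$ such that $\sigma$ is a face of some $n$-simplex of $L$ different from $\eta$. $K$ has an $(n-1)$-complete ordering if its $n$-simplices can be listed (each exactly once) as $\eta_1,\dots,\eta_t$, $t=|K^n|$, such that for each $2\le i\le t$, with $K_i=\overline{\{\eta_1,\dots,\eta_i\}}$, the attachment $\mathcal{A}(\eta_i,K_i)$ is a complete simplicial complex on $n$ vertices (i.e. consists of all non-empty subsets of some $n$-element vertex set). *)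

theory Defs imports Main begin

definition simplicial_complex :: "'a set \<Rightarrow> 'a set set \<Rightarrow> bool" where
  "simplicial_complex V K \<longleftrightarrow>
     finite V \<and> (\<forall>\<sigma>\<in>K. \<sigma> \<noteq> {} \<and> \<sigma> \<subseteq> V) \<and> (\<forall>v\<in>V. {v} \<in> K) \<and>
     (\<forall>\<sigma>\<in>K. \<forall>\<tau>. \<tau> \<noteq> {} \<and> \<tau> \<subseteq> \<sigma> \<longrightarrow> \<tau> \<in> K)"

text \<open>Simplices are non-empty, so the empty set is never a face.\<close>

definition is_face :: "'a set \<Rightarrow> 'a set \<Rightarrow> bool" where
  "is_face \<tau> \<sigma> \<longleftrightarrow> \<tau> \<noteq> {} \<and> \<tau> \<subseteq> \<sigma>"

definition simplices :: "nat \<Rightarrow> 'a set set \<Rightarrow> 'a set set" where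
  "simplices k K = {\<sigma>\<in>K. card \<sigma> = k + 1}"

definition complex_dim :: "'a set set \<Rightarrow> nat" where
  "complex_dim K = Max ((\<lambda>\<sigma>. card \<sigma> - 1) ` K)"

text \<open>Non-emptiness is required explicitly because \<^const>\<open>Max\<close> is unspecified on the empty set.\<close>

definition pure_complex :: "'a set \<Rightarrow> nat \<Rightarrow> 'a set set \<Rightarrow> bool" where
  "pure_complex V n K \<longleftrightarrow>
     simplicial_complex V K \<and> K \<noteq> {} \<and> complex_dim K = n \<and>
     (\<forall>\<sigma>\<in>K. \<exists>\<eta>\<in>simplices n K. is_face \<sigma> \<eta>)"

definition simplex_closure :: "'a set set \<Rightarrow> 'a set set" where
  "simplex_closure S = {\<tau>. \<exists>\<sigma>\<in>S. is_face \<tau> \<sigma>}"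

text \<open>
  A sequence \<open>\<sigma>\<^sub>1, \<eta>\<^sub>1, \<sigma>\<^sub>2, \<dots>, \<sigma>\<^sub>r, \<eta>\<^sub>r, \<sigma>\<^sub>r\<^sub>+\<^sub>1\<close> is given by its length \<open>r\<close> and two functions, of which
  only the values \<open>\<sigma> 1, \<dots>, \<sigma> (r + 1)\<close> and \<open>\<eta> 1, \<dots>, \<eta> r\<close> matter.
\<close>

definition walk_seq ::
  "'a set set \<Rightarrow> nat \<Rightarrow> nat \<Rightarrow> nat \<Rightarrow> (nat \<Rightarrow> 'a set) \<Rightarrow> (nat \<Rightarrow> 'a set) \<Rightarrow> bool" where
  "walk_seq K m n r \<sigma> \<eta> \<longleftrightarrow>
     1 \<le> r \<and>
     (\<forall>k\<in>{1..r+1}. \<sigma> k \<in> simplices m K) \<and>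
     (\<forall>k\<in>{1..r}. \<eta> k \<in> simplices n K \<and> \<sigma> k \<noteq> \<sigma> (k+1) \<and>
        is_face (\<sigma> k) (\<eta> k) \<and> is_face (\<sigma> (k+1)) (\<eta> k))"

definition path_seq ::
  "'a set set \<Rightarrow> nat \<Rightarrow> nat \<Rightarrow> nat \<Rightarrow> (nat \<Rightarrow> 'a set) \<Rightarrow> (nat \<Rightarrow> 'a set) \<Rightarrow> bool" where
  "path_seq K m n r \<sigma> \<eta> \<longleftrightarrow>
     walk_seq K m n r \<sigma> \<eta> \<and> inj_on \<sigma> {1..r+1} \<and> inj_on \<eta> {1..r} \<and>
     \<sigma> ` {1..r+1} \<inter> \<eta> ` {1..r} = {}"

definition connected_complex :: "nat \<Rightarrow> 'a set set \<Rightarrow> bool" where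
  "connected_complex n K \<longleftrightarrow>
     (\<forall>\<tau>\<in>simplices (n-1) K. \<forall>\<tau>'\<in>simplices (n-1) K. \<tau> \<noteq> \<tau>' \<longrightarrow>
        (\<exists>r \<sigma> \<eta>. path_seq K (n-1) n r \<sigma> \<eta> \<and> \<sigma> 1 = \<tau> \<and> \<sigma> (r+1) = \<tau>'))"

definition circuit_seq ::
  "'a set set \<Rightarrow> nat \<Rightarrow> nat \<Rightarrow> nat \<Rightarrow> (nat \<Rightarrow> 'a set) \<Rightarrow> (nat \<Rightarrow> 'a set) \<Rightarrow> bool" where
  "circuit_seq K m n r \<sigma> \<eta> \<longleftrightarrow>
     walk_seq K m n r \<sigma> \<eta> \<and> \<sigma> (r+1) = \<sigma> 1 \<and> inj_on \<sigma> {1..r} \<and> inj_on \<eta> {1..r}"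

definition simplicial_cycle_seq ::
  "'a set set \<Rightarrow> nat \<Rightarrow> nat \<Rightarrow> nat \<Rightarrow> (nat \<Rightarrow> 'a set) \<Rightarrow> (nat \<Rightarrow> 'a set) \<Rightarrow> bool" where
  "simplicial_cycle_seq K m n r \<sigma> \<eta> \<longleftrightarrow>
     circuit_seq K m n r \<sigma> \<eta> \<and> 3 \<le> r \<and>
     (\<forall>k\<in>{2..r-1}. \<not> is_face (\<sigma> 1) (\<eta> k)) \<and>
     (\<exists>\<sigma>'. (\<forall>z\<in>{2..r}. \<sigma>' z \<in> simplices (n-1) K \<and>
              is_face (\<sigma>' z) (\<eta> (z-1)) \<and> is_face (\<sigma>' z) (\<eta> z) \<and> is_face (\<sigma> z) (\<sigma>' z)) \<and>
           inj_on \<sigma>' {2..r})"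

definition acyclic_complex :: "nat \<Rightarrow> 'a set set \<Rightarrow> bool" where
  "acyclic_complex n K \<longleftrightarrow> \<not> (\<exists>m<n. \<exists>r \<sigma> \<eta>. simplicial_cycle_seq K m n r \<sigma> \<eta>)"

definition simplicial_tree :: "'a set \<Rightarrow> nat \<Rightarrow> 'a set set \<Rightarrow> bool" where
  "simplicial_tree V n K \<longleftrightarrow>
     pure_complex V n K \<and> connected_complex n K \<and> acyclic_complex n K"

definition attachment :: "nat \<Rightarrow> 'a set \<Rightarrow> 'a set set \<Rightarrow> 'a set set" where
  "attachment n \<eta> L =
     {\<sigma>. is_face \<sigma> \<eta> \<and> (\<exists>\<theta>\<in>simplices n L. \<theta> \<noteq> \<eta> \<and> is_face \<sigma> \<theta>)}"

definition complete_complex_on :: "nat \<Rightarrow> 'a set set \<Rightarrow> bool" where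
  "complete_complex_on k L \<longleftrightarrow> (\<exists>W. finite W \<and> card W = k \<and> L = {\<sigma>. \<sigma> \<noteq> {} \<and> \<sigma> \<subseteq> W})"

text \<open>For \<open>n \<ge> 1\<close>, this is an \<open>(n - 1)\<close>-complete ordering of the \<open>n\<close>-simplices.\<close>

definition has_complete_ordering :: "nat \<Rightarrow> 'a set set \<Rightarrow> bool" where
  "has_complete_ordering n K \<longleftrightarrow>
     (\<exists>\<eta>. bij_betw \<eta> {1..card (simplices n K)} (simplices n K) \<and>
        (\<forall>i\<in>{2..card (simplices n K)}.
           complete_complex_on n (attachment n (\<eta> i) (simplex_closure (\<eta> ` {1..i})))))"

end

theory Submission imports Defs begin

text \<open>
  Suppose a complete ordering is given and \<open>\<eta>\<^sub>j\<close> is the member of a simplicial cycle sequence that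
  comes last in the ordering. All other members meet \<open>\<eta>\<^sub>j\<close> inside one \<open>(n-1)\<close>-face \<open>W\<close>. For
  \<open>1 < j < r\<close> this forces two of the distinct \<open>\<sigma>'\<^sub>z\<close> to equal \<open>W\<close>; for \<open>j \<in> {1, r}\<close> it puts \<open>\<sigma>\<^sub>1\<close>
  inside a forbidden \<open>\<eta>\<^sub>k\<close>.

  Conversely, in a simplicial tree one grows the ordering greedily, always adding an \<open>n\<close>-simplex \<open>\<eta>\<close>
  that shares an \<open>(n-1)\<close>-face \<open>W\<close> with the simplices listed so far. If the attachment were larger than
  \<open>W\<close>, the vertex \<open>u\<close> of \<open>\<eta>\<close> outside \<open>W\<close> would occur in an earlier simplex, so that there is a chain of
  adjacent \<open>n\<close>-simplices that contains \<open>u\<close> at both (distinct) ends but nowhere else. In a shortest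
  such chain, taken over all vertices, every step enters a vertex not seen before, and these
  vertices form a \<open>(0,n)\<close>-simplicial cycle sequence.
\<close>

section \<open>Facets and attachments\<close>

lemma pure_complexD:
  assumes "pure_complex V n K"
  shows pure_complex_finite: "finite K"
    and pure_complex_finite_simplex: "\<sigma> \<in> K \<Longrightarrow> finite \<sigma>"
    and pure_complex_face: "\<sigma> \<in> K \<Longrightarrow> \<tau> \<noteq> {} \<Longrightarrow> \<tau> \<subseteq> \<sigma> \<Longrightarrow> \<tau> \<in> K"
    and pure_complex_facet: "\<sigma> \<in> K \<Longrightarrow> \<exists>\<eta>\<in>simplices n K. \<sigma> \<subseteq> \<eta>"
    and pure_complex_facets_nonempty: "simplices n K \<noteq> {}"
proof -
  have sc: "simplicial_complex V K" and ne: "K \<noteq> {}"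
    and cov: "\<forall>\<sigma>\<in>K. \<exists>\<eta>\<in>simplices n K. is_face \<sigma> \<eta>"
    using assms by (auto simp: pure_complex_def)
  have sub: "K \<subseteq> Pow V" and fV: "finite V"
    using sc by (auto simp: simplicial_complex_def)
  show "finite K" using sub fV by (meson finite_Pow_iff finite_subset)
  show "\<sigma> \<in> K \<Longrightarrow> finite \<sigma>" using sub fV by (meson PowD finite_subset subsetD)
  show "\<sigma> \<in> K \<Longrightarrow> \<tau> \<noteq> {} \<Longrightarrow> \<tau> \<subseteq> \<sigma> \<Longrightarrow> \<tau> \<in> K"
    using sc unfolding simplicial_complex_def by blast
  show "\<sigma> \<in> K \<Longrightarrow> \<exists>\<eta>\<in>simplices n K. \<sigma> \<subseteq> \<eta>"
    using cov unfolding is_face_def by blast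
  show "simplices n K \<noteq> {}" using cov ne by blast
qed

lemma simplices_simplex_closure:
  assumes "\<And>\<eta>. \<eta> \<in> S \<Longrightarrow> finite \<eta> \<and> card \<eta> = n + 1"
  shows "simplices n (simplex_closure S) = S"
proof
  show "simplices n (simplex_closure S) \<subseteq> S"
  proof
    fix \<tau> assume "\<tau> \<in> simplices n (simplex_closure S)"
    then obtain \<eta> where e: "\<eta> \<in> S" "\<tau> \<subseteq> \<eta>" "card \<tau> = n + 1"
      by (auto simp: simplices_def simplex_closure_def is_face_def)
    then have "\<tau> = \<eta>" using assms[OF e(1)] by (metis card_subset_eq)
    then show "\<tau> \<in> S" using e by simp
  qed
  show "S \<subseteq> simplices n (simplex_closure S)"
    using assms by (force simp: simplices_def simplex_closure_def is_face_def)
qed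

text \<open>Turns the attachment condition into plain set inclusions, the form used from here on. A
  complete attachment on \<open>W\<close> contains \<open>W\<close> itself, so one single earlier
  simplex contains all of \<open>W\<close>, while every intersection with an earlier simplex is a
  face in the attachment and hence lies in \<open>W\<close>.\<close>

lemma complete_attachment_iff:
  assumes S: "\<And>\<theta>. \<theta> \<in> S \<Longrightarrow> finite \<theta> \<and> card \<theta> = n + 1"
    and "\<eta> \<notin> S" "finite \<eta>" "card \<eta> = n + 1" "1 \<le> n"
  shows "complete_complex_on n (attachment n \<eta> (simplex_closure (insert \<eta> S))) \<longleftrightarrow>
    (\<exists>W. card W = n \<and> W \<subseteq> \<eta> \<and> (\<exists>\<theta>\<in>S. W \<subseteq> \<theta>) \<and> (\<forall>\<theta>\<in>S. \<eta> \<inter> \<theta> \<subseteq> W))"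
    (is "?L \<longleftrightarrow> ?R")
proof -
  have att: "attachment n \<eta> (simplex_closure (insert \<eta> S)) =
      {\<sigma>. \<sigma> \<noteq> {} \<and> \<sigma> \<subseteq> \<eta> \<and> (\<exists>\<theta>\<in>S. \<sigma> \<subseteq> \<theta>)}"
  proof -
    have "simplices n (simplex_closure (insert \<eta> S)) = insert \<eta> S"
      by (rule simplices_simplex_closure) (use assms in auto)
    then show ?thesis unfolding attachment_def is_face_def using \<open>\<eta> \<notin> S\<close> by auto
  qed
  show ?thesis
  proof
    assume ?L
    then obtain W where W: "finite W" "card W = n"
      and Weq: "{\<sigma>. \<sigma> \<noteq> {} \<and> \<sigma> \<subseteq> \<eta> \<and> (\<exists>\<theta>\<in>S. \<sigma> \<subseteq> \<theta>)} = {\<sigma>. \<sigma> \<noteq> {} \<and> \<sigma> \<subseteq> W}"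
      unfolding att complete_complex_on_def by (elim exE conjE) (rule that)
    have eq: "(\<sigma> \<noteq> {} \<and> \<sigma> \<subseteq> \<eta> \<and> (\<exists>\<theta>\<in>S. \<sigma> \<subseteq> \<theta>)) \<longleftrightarrow> (\<sigma> \<noteq> {} \<and> \<sigma> \<subseteq> W)" for \<sigma>
      using arg_cong[OF Weq, of "\<lambda>T. \<sigma> \<in> T"] by (simp only: mem_Collect_eq)
    \<comment> \<open>Only non-empty sets belong to the attachment, so \<open>W\<close> can be
      tested for membership only once it is known to be non-empty.\<close>
    have "W \<noteq> {}" using W(2) \<open>1 \<le> n\<close> by (metis card.empty not_one_le_zero)
    then have "W \<subseteq> \<eta> \<and> (\<exists>\<theta>\<in>S. W \<subseteq> \<theta>)" using iffD2[OF eq[of W]] by simp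
    moreover have "\<eta> \<inter> \<theta> \<subseteq> W" if "\<theta> \<in> S" for \<theta>
      using iffD1[OF eq[of "\<eta> \<inter> \<theta>"]] that by (cases "\<eta> \<inter> \<theta> = {}") auto
    ultimately show ?R using W(2) by blast
  next
    assume ?R
    then obtain W where W: "card W = n" "W \<subseteq> \<eta>" "\<exists>\<theta>\<in>S. W \<subseteq> \<theta>" "\<forall>\<theta>\<in>S. \<eta> \<inter> \<theta> \<subseteq> W" by blast
    have "\<sigma> \<subseteq> \<eta> \<and> (\<exists>\<theta>\<in>S. \<sigma> \<subseteq> \<theta>) \<longleftrightarrow> \<sigma> \<subseteq> W" for \<sigma>
      using W(2-4) by (meson Int_greatest order_trans)
    then have "{\<sigma>. \<sigma> \<noteq> {} \<and> \<sigma> \<subseteq> \<eta> \<and> (\<exists>\<theta>\<in>S. \<sigma> \<subseteq> \<theta>)} = {\<sigma>. \<sigma> \<noteq> {} \<and> \<sigma> \<subseteq> W}"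
      by simp
    moreover have "finite W" using W(2) \<open>finite \<eta>\<close> finite_subset by blast
    ultimately show ?L unfolding att complete_complex_on_def using W(1) by (intro exI[of _ W] conjI)
  qed
qed

lemma complete_attachment_step_iff:
  fixes \<eta> :: "nat \<Rightarrow> 'a set"
  assumes "inj_on \<eta> {1..t}" "i \<in> {2..t}" "1 \<le> n"
    and F: "\<And>i. i \<in> {1..t} \<Longrightarrow> finite (\<eta> i) \<and> card (\<eta> i) = n + 1"
  shows "complete_complex_on n (attachment n (\<eta> i) (simplex_closure (\<eta> ` {1..i}))) \<longleftrightarrow>
    (\<exists>W. card W = n \<and> W \<subseteq> \<eta> i \<and> (\<exists>j\<in>{1..<i}. W \<subseteq> \<eta> j) \<and> (\<forall>j\<in>{1..<i}. \<eta> i \<inter> \<eta> j \<subseteq> W))"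
proof -
  have "{1..i} = insert i {1..<i}" using assms(2) by auto
  then have im: "\<eta> ` {1..i} = insert (\<eta> i) (\<eta> ` {1..<i})" by simp
  have "\<eta> i \<notin> \<eta> ` {1..<i}"
  proof
    assume "\<eta> i \<in> \<eta> ` {1..<i}"
    then obtain j where "j \<in> {1..<i}" "\<eta> i = \<eta> j" by blast
    then show False using inj_onD[OF assms(1), of i j] assms(2) by auto
  qed
  then show ?thesis
    unfolding im by (subst complete_attachment_iff) (use assms F in auto)
qed

section \<open>Complete orderings yield trees\<close>

lemma complete_ordering_acyclic:
  fixes \<eta> :: "nat \<Rightarrow> 'a set"
  assumes bij: "bij_betw \<eta> {1..t} (simplices n K)" and n: "1 \<le> n"
    and W: "\<And>i. i \<in> {2..t} \<Longrightarrow> card (W i) = n \<and> (\<forall>j\<in>{1..<i}. \<eta> i \<inter> \<eta> j \<subseteq> W i)"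
  shows "acyclic_complex n K"
  unfolding acyclic_complex_def
proof
  assume "\<exists>m<n. \<exists>r \<sigma> \<eta>. simplicial_cycle_seq K m n r \<sigma> \<eta>"
  then obtain m r \<sigma> \<theta> where cyc: "simplicial_cycle_seq K m n r \<sigma> \<theta>" by blast
  then obtain \<sigma>' where r: "3 \<le> r"
    and \<sigma>': "\<And>z. z \<in> {2..r} \<Longrightarrow> \<sigma>' z \<in> simplices (n-1) K \<and> \<sigma>' z \<subseteq> \<theta> (z-1) \<and> \<sigma>' z \<subseteq> \<theta> z"
    and inj': "inj_on \<sigma>' {2..r}" and inj\<theta>: "inj_on \<theta> {1..r}"
    and avoid: "\<And>k. k \<in> {2..r-1} \<Longrightarrow> \<not> is_face (\<sigma> 1) (\<theta> k)"
    and \<theta>: "\<And>k. k \<in> {1..r} \<Longrightarrow> \<theta> k \<in> simplices n K"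
    and f1: "is_face (\<sigma> 1) (\<theta> 1)" and fr: "is_face (\<sigma> 1) (\<theta> r)"
    unfolding simplicial_cycle_seq_def circuit_seq_def walk_seq_def is_face_def
    by (smt (verit) atLeastAtMost_iff le_refl one_le_numeral order_trans)
  \<comment> \<open>Position in the given ordering of the \<open>k\<close>-th n-simplex of the
    cycle; \<open>j\<close> below is the index at which it is largest.\<close>
  define pos where "pos = (\<lambda>k. inv_into {1..t} \<eta> (\<theta> k))"
  have pos: "pos k \<in> {1..t} \<and> \<eta> (pos k) = \<theta> k" if "k \<in> {1..r}" for k
    using \<theta>[OF that] bij unfolding pos_def bij_betw_def
    by (metis f_inv_into_f inv_into_into)
  have "Max (pos ` {1..r}) \<in> pos ` {1..r}" using r by (intro Max_in) auto
  then obtain j where j: "j \<in> {1..r}" "pos j = Max (pos ` {1..r})" by force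
  have less: "pos k < pos j" if "k \<in> {1..r}" "k \<noteq> j" for k
  proof -
    have "pos k \<le> pos j" using j that by simp
    moreover have "pos k \<noteq> pos j" using pos[OF that(1)] pos[OF j(1)] inj\<theta> that j(1)
      by (metis inj_onD)
    ultimately show ?thesis by simp
  qed
  have "\<exists>k\<in>{1..r}. k \<noteq> j" using r by (intro bexI[of _ "if j = 1 then 2 else 1"]) auto
  \<comment> \<open>Some other member of the cycle is listed before \<open>\<theta> j\<close>, so
    \<open>pos j\<close> is not 1 and an attaching set \<open>W (pos j)\<close> is
    available.\<close>
  then have j2: "pos j \<in> {2..t}" using less pos j(1) by fastforce
  define U where "U = W (pos j)"
  have U: "card U = n" and meet: "\<And>k. k \<in> {1..r} \<Longrightarrow> k \<noteq> j \<Longrightarrow> \<theta> j \<inter> \<theta> k \<subseteq> U"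
    using W[OF j2] less pos j(1) unfolding U_def by (auto, fastforce)
  have finU: "finite U" using U n card.infinite by force
  \<comment> \<open>Each such \<open>\<sigma>' z\<close> lies in \<open>\<theta> j\<close> and in a
    neighbour of it in the cycle, hence in \<open>U\<close>; both sets have n elements.\<close>
  have eqU: "\<sigma>' z = U" if "z \<in> {2..r}" "z = j \<or> z - 1 = j" for z
  proof -
    have zz: "z \<in> {1..r}" "z - 1 \<in> {1..r}" "z \<noteq> z - 1" using that(1) by auto
    have "\<sigma>' z \<subseteq> U"
      using that(2)
    proof
      assume "z = j" then show ?thesis using \<sigma>'[OF that(1)] meet[of "z-1"] zz by simp blast
    next
      assume "z - 1 = j" then show ?thesis using \<sigma>'[OF that(1)] meet[of z] zz by simp blast
    qed
    moreover have "card (\<sigma>' z) = n" using \<sigma>'[OF that(1)] n by (simp add: simplices_def)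
    ultimately show ?thesis using finU U by (simp add: card_subset_eq)
  qed
  consider "j = 1" | "j = r" | "2 \<le> j" "j + 1 \<le> r" using j(1) by force
  then show False
  proof cases
    case 1
    \<comment> \<open>The circuit closes up, so \<open>\<sigma> 1\<close> is a face of both
      \<open>\<theta> 1\<close> and \<open>\<theta> r\<close> and lies in \<open>U\<close>, which is
      the face shared with \<open>\<theta> 2\<close>. The case \<open>j = r\<close> is the mirror
      image.\<close>
    have "\<sigma> 1 \<subseteq> U" using f1 fr meet[of r] 1 r unfolding is_face_def by auto
    also have "U \<subseteq> \<theta> 2" using eqU[of 2] \<sigma>'[of 2] 1 r by auto
    finally show False using avoid[of 2] f1 r by (auto simp: is_face_def)
  next
    case 2
    have "\<sigma> 1 \<subseteq> U" using f1 fr meet[of 1] 2 r unfolding is_face_def by auto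
    also have "U \<subseteq> \<theta> (r-1)" using eqU[of r] \<sigma>'[of r] 2 r by auto
    finally show False using avoid[of "r-1"] f1 r by (auto simp: is_face_def)
  next
    case 3
    then have "\<sigma>' j = \<sigma>' (j+1)" using eqU[of j] eqU[of "j+1"] by auto
    then show False using inj_onD[OF inj', of j "j+1"] 3 by auto
  qed
qed

section \<open>Shortest walks and connectedness\<close>

text \<open>Replacing a segment of a walk of least length by a shorter one would shorten the whole
  walk. The last conclusion is used with \<open>d = 0\<close> to exclude repetitions and with
  \<open>d = 1\<close> to exclude chords.\<close>

lemma shortest_relpow_walk:
  assumes "(a, b) \<in> S\<^sup>*"
  obtains r f where "f 0 = a" "f r = b" "\<And>i. i < r \<Longrightarrow> (f i, f (Suc i)) \<in> S"
    "\<And>i j d. i \<le> j \<Longrightarrow> j \<le> r \<Longrightarrow> (f i, f j) \<in> S ^^ d \<Longrightarrow> j \<le> i + d"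
proof -
  have ex: "\<exists>r. (a, b) \<in> S ^^ r" using assms rtrancl_imp_relpow by blast
  define r where "r = (LEAST r. (a, b) \<in> S ^^ r)"
  have "(a, b) \<in> S ^^ r" unfolding r_def using ex by (rule LeastI_ex)
  then obtain f where f: "f 0 = a" "f r = b" "\<And>i. i < r \<Longrightarrow> (f i, f (Suc i)) \<in> S"
    by (auto simp: relpow_fun_conv)
  have seg: "(f i, f j) \<in> S ^^ (j - i)" if "i \<le> j" "j \<le> r" for i j
    unfolding relpow_fun_conv using that f(3)
    by (intro exI[of _ "\<lambda>k. f (i + k)"]) auto
  have "j \<le> i + d" if "i \<le> j" "j \<le> r" "(f i, f j) \<in> S ^^ d" for i j d
  proof -
    have "(a, f j) \<in> S ^^ (i + d)"
      using seg[of 0 i] that f(1) by (auto simp: relpow_add)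
    then have "(a, b) \<in> S ^^ ((i + d) + (r - j))"
      using seg[of j r] that f(2) unfolding relpow_add[of "i+d"] by blast
    then have "r \<le> (i + d) + (r - j)" unfolding r_def by (rule Least_le)
    then show ?thesis using that by linarith
  qed
  then show thesis using that f by blast
qed

text \<open>Distinctness comes from taking a shortest walk: a repeated (n-1)-simplex could be
  bypassed in 0 steps, and a repeated n-simplex would join the first and last of the faces around it
  in a single step.\<close>

lemma path_seq_of_rtrancl:
  fixes K :: "'a set set"
  assumes n: "1 \<le> n"
    and S: "S = {(\<sigma>, \<sigma>'). \<sigma> \<in> simplices (n-1) K \<and> \<sigma>' \<in> simplices (n-1) K \<and> \<sigma> \<noteq> \<sigma>' \<and>
                 (\<exists>\<eta>\<in>simplices n K. \<sigma> \<subseteq> \<eta> \<and> \<sigma>' \<subseteq> \<eta>)}"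
    and "(\<tau>, \<tau>') \<in> S\<^sup>*" "\<tau> \<noteq> \<tau>'"
  shows "\<exists>r \<sigma> \<eta>. path_seq K (n-1) n r \<sigma> \<eta> \<and> \<sigma> 1 = \<tau> \<and> \<sigma> (r+1) = \<tau>'"
proof -
  obtain r f where f: "f 0 = \<tau>" "f r = \<tau>'" and step: "\<And>i. i < r \<Longrightarrow> (f i, f (Suc i)) \<in> S"
    and short: "\<And>i j d. i \<le> j \<Longrightarrow> j \<le> r \<Longrightarrow> (f i, f j) \<in> S ^^ d \<Longrightarrow> j \<le> i + d"
    using shortest_relpow_walk[OF assms(3)] by blast
  have r: "1 \<le> r" using f assms(4) by (cases r) auto
  have "\<forall>i. \<exists>\<eta>. i < r \<longrightarrow> \<eta> \<in> simplices n K \<and> f i \<subseteq> \<eta> \<and> f (Suc i) \<subseteq> \<eta>"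
    using step unfolding S by blast
  then obtain g where g: "\<And>i. i < r \<Longrightarrow> g i \<in> simplices n K \<and> f i \<subseteq> g i \<and> f (Suc i) \<subseteq> g i"
    by metis
  have fs: "f i \<in> simplices (n-1) K" if "i \<le> r" for i
    using step[of i] step[of "i-1"] that r unfolding S by (cases i) (auto simp: Suc_le_eq)
  have inf: "i = j" if "i \<le> j" "j \<le> r" "f i = f j" for i j
    using short[of i j 0] that by simp
  have ing: "i = j" if "i \<le> j" "j < r" "g i = g j" for i j
  proof -
    have "f i \<subseteq> g j" "f (Suc j) \<subseteq> g j" "g j \<in> simplices n K" using g[of i] g[of j] that by auto
    moreover have "f i \<noteq> f (Suc j)" using inf[of i "Suc j"] that by auto
    ultimately have "(f i, f (Suc j)) \<in> S" using fs[of i] fs[of "Suc j"] that unfolding S by auto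
    then show ?thesis using short[of i "Suc j" 1] that by simp
  qed
  \<comment> \<open>The walk is indexed from 0, path sequences from 1.\<close>
  define \<sigma> where "\<sigma> = (\<lambda>k. f (k - 1))"
  define \<eta> where "\<eta> = (\<lambda>k. g (k - 1))"
  have walk: "walk_seq K (n-1) n r \<sigma> \<eta>"
    unfolding walk_seq_def
  proof (intro conjI ballI)
    fix k assume k: "k \<in> {1..r}"
    then obtain i where i: "k = Suc i" "i < r" by (cases k) auto
    have "f i \<noteq> {}" "f (Suc i) \<noteq> {}"
      using fs[of i] fs[of "Suc i"] i n unfolding simplices_def by auto
    then show "\<eta> k \<in> simplices n K" "\<sigma> k \<noteq> \<sigma> (k + 1)" "is_face (\<sigma> k) (\<eta> k)"
      "is_face (\<sigma> (k + 1)) (\<eta> k)"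
      using g[of i] step[of i] i unfolding \<sigma>_def \<eta>_def S is_face_def by auto
  qed (use r fs in \<open>auto simp: \<sigma>_def\<close>)
  have "inj_on \<sigma> {1..r+1}"
    unfolding \<sigma>_def
  proof (rule linorder_inj_onI)
    fix y z assume "y < z" "y \<in> {1..r+1}" "z \<in> {1..r+1}"
    then have "y - 1 < z - 1" "z - 1 \<le> r" by auto
    then show "f (y-1) \<noteq> f (z-1)" using inf[of "y-1" "z-1"] by auto
  qed auto
  moreover have "inj_on \<eta> {1..r}"
    unfolding \<eta>_def
  proof (rule linorder_inj_onI)
    fix y z assume "y < z" "y \<in> {1..r}" "z \<in> {1..r}"
    then have "y - 1 < z - 1" "z - 1 < r" by auto
    then show "g (y-1) \<noteq> g (z-1)" using ing[of "y-1" "z-1"] by auto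
  qed auto
  \<comment> \<open>The two kinds of simplices have n and n + 1 vertices respectively.\<close>
  moreover have "\<sigma> ` {1..r+1} \<inter> \<eta> ` {1..r} = {}"
  proof -
    have "card \<tau> = n" if "\<tau> \<in> \<sigma> ` {1..r+1}" for \<tau>
      using that fs n by (auto simp: \<sigma>_def simplices_def)
    moreover have "card \<tau> = n + 1" if "\<tau> \<in> \<eta> ` {1..r}" for \<tau>
      using that walk by (auto simp: walk_seq_def simplices_def)
    ultimately have "\<tau> \<notin> \<eta> ` {1..r}" if "\<tau> \<in> \<sigma> ` {1..r+1}" for \<tau> using that by (metis n_not_Suc_n Suc_eq_plus1)
    then show ?thesis by blast
  qed
  ultimately have "path_seq K (n-1) n r \<sigma> \<eta>" using walk unfolding path_seq_def by blast
  moreover have "\<sigma> 1 = \<tau>" "\<sigma> (r+1) = \<tau>'" using f by (simp_all add: \<sigma>_def)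
  ultimately show ?thesis by blast
qed

text \<open>Any two n-element subsets of one n-simplex are equal or adjacent, and \<open>W i\<close>
  lies both in \<open>\<eta> i\<close> and in an earlier simplex. Strong induction on the position
  thus reaches every (n-1)-simplex from one fixed face of \<open>\<eta> 1\<close>.\<close>

lemma complete_ordering_connected:
  fixes \<eta> :: "nat \<Rightarrow> 'a set"
  assumes pure: "pure_complex V n K" and n: "1 \<le> n"
    and bij: "bij_betw \<eta> {1..t} (simplices n K)"
    and W: "\<And>i. i \<in> {2..t} \<Longrightarrow> card (W i) = n \<and> W i \<subseteq> \<eta> i \<and> (\<exists>j\<in>{1..<i}. W i \<subseteq> \<eta> j)"
  shows "connected_complex n K"
proof -
  define S where "S = {(\<sigma>, \<sigma>'). \<sigma> \<in> simplices (n-1) K \<and> \<sigma>' \<in> simplices (n-1) K \<and> \<sigma> \<noteq> \<sigma>' \<and>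
                 (\<exists>\<eta>\<in>simplices n K. \<sigma> \<subseteq> \<eta> \<and> \<sigma>' \<subseteq> \<eta>)}"
  have \<eta>: "\<eta> i \<in> simplices n K" if "i \<in> {1..t}" for i
    using bij that by (auto simp: bij_betw_def)
  have sub: "\<tau> \<in> simplices (n-1) K" if "\<tau> \<subseteq> \<eta> i" "card \<tau> = n" "i \<in> {1..t}" for \<tau> i
  proof -
    have "\<tau> \<noteq> {}" using that n by auto
    then have "\<tau> \<in> K" using pure_complex_face[OF pure, of "\<eta> i"] \<eta>[OF that(3)] that(1)
      by (auto simp: simplices_def)
    then show ?thesis using that n by (simp add: simplices_def)
  qed
  have adj: "(\<tau>, \<tau>') \<in> S\<^sup>*"
    if "\<tau> \<subseteq> \<eta> i" "card \<tau> = n" "\<tau>' \<subseteq> \<eta> i" "card \<tau>' = n" "i \<in> {1..t}" for \<tau> \<tau>' i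
    using sub[OF that(1,2,5)] sub[OF that(3,4,5)] \<eta>[OF that(5)] that
    by (cases "\<tau> = \<tau>'") (auto simp: S_def)
  have "simplices n K \<noteq> {}" by (rule pure_complex_facets_nonempty[OF pure])
  then have t: "1 \<le> t" using bij by (cases t) (auto simp: bij_betw_def)
  then have "n \<le> card (\<eta> 1)" using \<eta>[of 1] by (simp add: simplices_def)
  then obtain \<tau>0 where \<tau>0: "\<tau>0 \<subseteq> \<eta> 1" "card \<tau>0 = n"
    by (meson obtain_subset_with_card_n)
  have base: "\<forall>\<tau>. \<tau> \<subseteq> \<eta> i \<and> card \<tau> = n \<longrightarrow> (\<tau>0, \<tau>) \<in> S\<^sup>*" if "i \<in> {1..t}" for i
    using that
  proof (induction i rule: less_induct)
    case (less i)
    show ?case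
    proof (intro allI impI, elim conjE)
      fix \<tau> assume \<tau>: "\<tau> \<subseteq> \<eta> i" "card \<tau> = n"
      show "(\<tau>0, \<tau>) \<in> S\<^sup>*"
      proof (cases "i = 1")
        case True then show ?thesis using adj[of \<tau>0 1 \<tau>] \<tau>0 \<tau> t by auto
      next
        case False
        then have i: "i \<in> {2..t}" using less.prems by auto
        then obtain j where j: "j \<in> {1..<i}" "W i \<subseteq> \<eta> j" using W by blast
        then have "(\<tau>0, W i) \<in> S\<^sup>*" using less.IH[of j] W[OF i] less.prems by auto
        moreover have "(W i, \<tau>) \<in> S\<^sup>*" using adj[of "W i" i \<tau>] W[OF i] \<tau> less.prems by blast
        ultimately show ?thesis by (rule rtrancl_trans)
      qed
    qed
  qed
  have reach: "(\<tau>0, \<tau>) \<in> S\<^sup>*" if "\<tau> \<in> simplices (n-1) K" for \<tau>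
  proof -
    have "\<tau> \<in> K" using that by (simp add: simplices_def)
    then obtain \<theta> where "\<theta> \<in> simplices n K" "\<tau> \<subseteq> \<theta>"
      using pure_complex_facet[OF pure] by blast
    moreover then obtain i where "i \<in> {1..t}" "\<theta> = \<eta> i" using bij unfolding bij_betw_def by blast
    ultimately show ?thesis using base that n by (auto simp: simplices_def)
  qed
  have "sym S" by (auto simp: sym_def S_def)
  then have "(\<tau>, \<tau>') \<in> S\<^sup>*" if "\<tau> \<in> simplices (n-1) K" "\<tau>' \<in> simplices (n-1) K" for \<tau> \<tau>'
    using reach[OF that(1)] reach[OF that(2)] by (meson rtrancl_trans symD sym_rtrancl)
  then show ?thesis
    unfolding connected_complex_def using path_seq_of_rtrancl[OF n S_def] by blast
qed

section \<open>Facet loops\<close>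

text \<open>
  Repetitions inside the chain are allowed, so that cutting out a segment preserves the property; a
  shortest loop has none.
\<close>

definition facet_loop ::
  "nat \<Rightarrow> 'a set set \<Rightarrow> nat \<Rightarrow> (nat \<Rightarrow> 'a set) \<Rightarrow> (nat \<Rightarrow> 'a set) \<Rightarrow> 'a \<Rightarrow> bool" where
  "facet_loop n F k \<rho> A u \<longleftrightarrow>
     2 \<le> k \<and> (\<forall>j\<le>k. \<rho> j \<in> F) \<and>
     (\<forall>j\<in>{1..k}. A j \<subseteq> \<rho> (j-1) \<and> A j \<subseteq> \<rho> j \<and> card (A j) = n) \<and>
     u \<in> \<rho> 0 \<and> u \<in> \<rho> k \<and> \<rho> 0 \<noteq> \<rho> k \<and> (\<forall>j\<in>{0<..<k}. u \<notin> \<rho> j)"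

text \<open>The members from \<open>\<rho> i\<close> to \<open>\<rho> (j-1)\<close> are cut out, and
  \<open>A i\<close> becomes the face shared by \<open>\<rho> (i-1)\<close> and
  \<open>\<rho> j\<close>. The pair \<open>i = 1\<close>, \<open>j = k\<close> is excluded because
  it would leave length 1.\<close>

lemma facet_loop_shortcut:
  assumes loop: "facet_loop n F k \<rho> A u" and ij: "1 \<le> i" "i < j" "j \<le> k" "i \<noteq> 1 \<or> j \<noteq> k"
    and sub: "A i \<subseteq> \<rho> j"
  shows "\<exists>\<rho>' A'. facet_loop n F (k - (j - i)) \<rho>' A' u"
proof -
  define \<rho>' where "\<rho>' = (\<lambda>t. if t < i then \<rho> t else \<rho> (t + (j - i)))"
  define A' where "A' = (\<lambda>t. if t \<le> i then A t else A (t + (j - i)))"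
  define d where "d = j - i"
  have d: "j = i + d" "1 \<le> d" using ij by (auto simp: d_def)
  have "facet_loop n F (k - (j - i)) \<rho>' A' u"
    unfolding facet_loop_def
  proof (intro conjI ballI)
    fix t assume t: "t \<in> {1..k - (j - i)}"
    have A: "A s \<subseteq> \<rho> (s-1)" "A s \<subseteq> \<rho> s" "card (A s) = n" if "s \<in> {1..k}" for s
      using loop that by (auto simp: facet_loop_def)
    have tk: "t \<le> k" using t by auto
    consider "t < i" | "t = i" | "i < t" by linarith
    then have "A' t \<subseteq> \<rho>' (t-1) \<and> A' t \<subseteq> \<rho>' t \<and> card (A' t) = n"
    proof cases
      case 1 then show ?thesis using A[of t] t tk by (auto simp: \<rho>'_def A'_def)
    next
      case 2 then show ?thesis using A[of t] t tk sub ij by (auto simp: \<rho>'_def A'_def)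
    next
      case 3
      then have "t + d - 1 = t - 1 + d" by simp
      then show ?thesis using A[of "t + d"] t 3 ij by (auto simp: \<rho>'_def A'_def d_def[symmetric] d(1))
    qed
    then show "A' t \<subseteq> \<rho>' (t-1)" "A' t \<subseteq> \<rho>' t" "card (A' t) = n" by auto
  qed (use loop ij in \<open>auto simp: facet_loop_def \<rho>'_def\<close>)
  then show ?thesis by blast
qed

lemma insert_eq_of_card:
  assumes "A \<subseteq> B" "card A = n" "finite B" "card B = n + 1" "x \<in> B" "x \<notin> A"
  shows "B = insert x A"
proof -
  have "finite A" using assms(1,3) by (rule finite_subset)
  then have "card (insert x A) = card B" using assms by simp
  moreover have "insert x A \<subseteq> B" using assms by simp
  ultimately show ?thesis using card_subset_eq[OF assms(3)] by metis
qed

text \<open>Minimality of \<open>k\<close> is applied in two ways: to a shortcut of the loop at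
  \<open>u\<close>, and to a segment of it that is a loop at another vertex. The resulting cycle has
  \<open>m = 0\<close> and \<open>r = k + 1\<close>.\<close>

lemma facet_loop_imp_cycle:
  fixes K :: "'a set set"
  assumes pure: "pure_complex V n K" and n: "1 \<le> n"
    and "facet_loop n (simplices n K) k0 \<rho>0 A0 u0"
  shows "\<not> acyclic_complex n K"
proof -
  \<comment> \<open>The base vertex is quantified as well, so that a shorter loop at any vertex
    contradicts minimality.\<close>
  define P where "P = (\<lambda>k. \<exists>\<rho> A u. facet_loop n (simplices n K) k \<rho> A u)"
  define k where "k = (LEAST k. P k)"
  have "P k" unfolding k_def by (rule LeastI[of P k0]) (use assms(3) in \<open>auto simp: P_def\<close>)
  then obtain \<rho> A u where loop: "facet_loop n (simplices n K) k \<rho> A u"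
    unfolding P_def by blast
  have min: "\<not> facet_loop n (simplices n K) k' \<rho>' A' u'" if "k' < k" for k' \<rho>' A' u'
    using not_less_Least[of k' P] that unfolding k_def P_def by blast
  have k2: "2 \<le> k" and \<rho>: "\<And>j. j \<le> k \<Longrightarrow> \<rho> j \<in> simplices n K"
    and A: "\<And>j. j \<in> {1..k} \<Longrightarrow> A j \<subseteq> \<rho> (j-1) \<and> A j \<subseteq> \<rho> j \<and> card (A j) = n"
    and u: "u \<in> \<rho> 0" "u \<in> \<rho> k" "\<rho> 0 \<noteq> \<rho> k" "\<And>j. 0 < j \<Longrightarrow> j < k \<Longrightarrow> u \<notin> \<rho> j"
    using loop by (auto simp: facet_loop_def)
  have fin: "finite (\<rho> j)" "card (\<rho> j) = n + 1" if "j \<le> k" for j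
    using \<rho>[OF that] pure_complex_finite_simplex[OF pure] by (auto simp: simplices_def)
  \<comment> \<open>Otherwise the loop could be shortened. In the exceptional case
    \<open>i = 1\<close>, \<open>j = k\<close> both ends would be \<open>A 1\<close> together with
    \<open>u\<close>, although they are distinct.\<close>
  have far: "\<not> A i \<subseteq> \<rho> j" if ij: "1 \<le> i" "i < j" "j \<le> k" for i j
  proof
    assume sub: "A i \<subseteq> \<rho> j"
    show False
    proof (cases "i = 1 \<and> j = k")
      case True
      then have "u \<notin> A 1" using u(4)[of 1] A[of 1] k2 by auto
      then have "\<rho> 0 = insert u (A 1)" "\<rho> k = insert u (A 1)"
        using insert_eq_of_card[of "A 1" "\<rho> 0" n u] insert_eq_of_card[of "A 1" "\<rho> k" n u]
          A[of 1] fin[of 0] fin[of k] u(1,2) sub True k2 by auto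
      then show False using u(3) by simp
    next
      case False
      then obtain \<rho>' A' where "facet_loop n (simplices n K) (k - (j - i)) \<rho>' A' u"
        using facet_loop_shortcut[OF loop ij _ sub] by blast
      then show False using min[of "k - (j - i)"] ij by auto
    qed
  qed
  have A_neq: "A i \<noteq> A j" if "1 \<le> i" "i < j" "j \<le> k" for i j
    using far[OF that] A[of j] that by auto
  have \<rho>_neq: "\<rho> i \<noteq> \<rho> j" if "i < j" "j \<le> k" for i j
  proof (cases "i = 0")
    case True then show ?thesis using u that by (cases "j = k") auto
  next
    case False then show ?thesis using far[of i j] A[of i] that by auto
  qed
  have "\<exists>v. v \<in> \<rho> j \<and> v \<notin> A j" if "j \<in> {1..k}" for j
  proof -
    have "A j \<noteq> \<rho> j" using A[OF that] fin(2)[of j] that by auto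
    then show ?thesis using A[OF that] by blast
  qed
  \<comment> \<open>\<open>v j\<close> is the one vertex gained on passing from \<open>A j\<close>
    to \<open>\<rho> j\<close>.\<close>
  then obtain v where v: "\<And>j. j \<in> {1..k} \<Longrightarrow> v j \<in> \<rho> j \<and> v j \<notin> A j" by metis
  have ins: "\<rho> j = insert (v j) (A j)" if "j \<in> {1..k}" for j
    using insert_eq_of_card[of "A j" "\<rho> j" n "v j"] A[OF that] v[OF that] fin[of j] that by auto
  \<comment> \<open>Between its last earlier occurrence \<open>l\<close> and \<open>j\<close>, the
    vertex \<open>v j\<close> would span a shorter loop. The index \<open>j = k\<close> is left out
    because there the entering vertex is \<open>u\<close>, which already lies in
    \<open>\<rho> 0\<close>.\<close>
  have new: "v j \<notin> \<rho> i" if "i < j" "j < k" for i j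
  proof
    assume "v j \<in> \<rho> i"
    define I where "I = {i. i < j \<and> v j \<in> \<rho> i}"
    define l where "l = Max I"
    have "finite I" "I \<noteq> {}" using \<open>v j \<in> \<rho> i\<close> that by (auto simp: I_def)
    then have l: "l < j" "v j \<in> \<rho> l" and lmax: "\<And>i. l < i \<Longrightarrow> i < j \<Longrightarrow> v j \<notin> \<rho> i"
      using Max_in[of I] Max_ge[of I] unfolding l_def[symmetric]
      by (auto simp: I_def) (metis leD)
    \<comment> \<open>This secures the minimum length 2 of a loop: if \<open>l = j - 1\<close>, then
      \<open>\<rho> (j-1)\<close> and \<open>\<rho> j\<close> would both be \<open>A j\<close>
      together with \<open>v j\<close>.\<close>
    have "l \<noteq> j - 1"
    proof
      assume l1: "l = j - 1"
      have "\<rho> (j-1) = insert (v j) (A j)"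
        using insert_eq_of_card[of "A j" "\<rho> (j-1)" n "v j"] A[of j] v[of j] fin[of "j-1"] l l1 that
        by auto
      then show False using \<rho>_neq[of "j-1" j] ins[of j] that l by auto
    qed
    then have "facet_loop n (simplices n K) (j - l) (\<lambda>t. \<rho> (l + t)) (\<lambda>t. A (l + t)) (v j)"
      unfolding facet_loop_def
    proof (intro conjI ballI)
      fix s assume s: "s \<in> {1..j - l}"
      then have "l + s - 1 = l + (s - 1)" "l + s \<in> {1..k}" using that l(1) by auto
      then show "A (l + s) \<subseteq> \<rho> (l + (s - 1))" "A (l + s) \<subseteq> \<rho> (l + s)" "card (A (l + s)) = n"
        using A[of "l + s"] by simp_all
    qed (use l lmax that \<rho> v[of j] \<rho>_neq[of l j] in auto)
    then show False using min[of "j - l"] that by simp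
  qed
  \<comment> \<open>A face \<open>A (j+1)\<close> of \<open>\<rho> j\<close> that misses
    \<open>v j\<close> would coincide with \<open>A j\<close>.\<close>
  have vA: "v j \<in> A (j+1)" if "1 \<le> j" "j < k" for j
  proof (rule ccontr)
    assume "v j \<notin> A (j+1)"
    then have "A (j+1) \<subseteq> A j" using A[of "j+1"] ins[of j] that by auto
    moreover have "finite (A j)" using A[of j] fin[of j] that finite_subset by auto
    ultimately have "A (j+1) = A j"
      using A[of j] A[of "j+1"] that by (intro card_subset_eq) auto
    then show False using A_neq[of j "j+1"] that by auto
  qed
  have "A 1 \<noteq> {}" using A[of 1] n k2 by auto
  then obtain a where a: "a \<in> A 1" by blast
  \<comment> \<open>\<open>x z\<close> is the vertex of the \<open>z\<close>-th \<open>0\<close>-simplex of the cycle, counted from \<open>1\<close>.\<close>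
  define x where "x = (\<lambda>z. if z = 1 \<or> z = k + 2 then u else if z = 2 then a else v (z - 2))"
  \<comment> \<open>\<open>A (z-1)\<close> will serve as \<open>\<sigma>' z\<close>: it is shared by
    \<open>\<rho> (z-2)\<close> and \<open>\<rho> (z-1)\<close>, which become the n-simplices
    numbered \<open>z - 1\<close> and \<open>z\<close> of the cycle.\<close>
  have xA: "x z \<in> A (z-1)" if "z \<in> {2..k+1}" for z
  proof (cases "z = 2")
    case False
    then have "z - 2 + 1 = z - 1" "1 \<le> z - 2" "z - 2 < k" using that by auto
    then show ?thesis using vA[of "z-2"] False that by (auto simp: x_def)
  qed (use a that in \<open>auto simp: x_def\<close>)
  have Az: "A (z-1) \<subseteq> \<rho> (z-2)" "A (z-1) \<subseteq> \<rho> (z-1)" if "z \<in> {2..k+1}" for z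
  proof -
    have "z - 1 \<in> {1..k}" "z - 1 - 1 = z - 2" using that by auto
    then show "A (z-1) \<subseteq> \<rho> (z-2)" "A (z-1) \<subseteq> \<rho> (z-1)" using A[of "z-1"] by simp_all
  qed
  have x_u: "x z \<noteq> u" if "z \<in> {2..k+1}" for z
  proof -
    have "z - 1 < k \<or> z - 2 < k \<and> 0 < z - 2" using that k2 by auto
    moreover have "x z \<in> \<rho> (z-1)" using xA[OF that] Az[OF that] by blast
    moreover have "x z \<in> \<rho> (z-2)" using xA[OF that] Az[OF that] by blast
    ultimately show ?thesis using u(4)[of "z-1"] u(4)[of "z-2"] that by auto
  qed
  \<comment> \<open>Since \<open>z\<close> is at least 3, \<open>x z\<close> is
    \<open>v (z-2)\<close>, which is new at index \<open>z - 2\<close>, whereas \<open>x y\<close>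
    already occurs in \<open>\<rho> (y-2)\<close>.\<close>
  have x_neq: "x y \<noteq> x z" if "y \<in> {2..k+1}" "z \<in> {2..k+1}" "y < z" for y z
  proof -
    have "x y \<in> \<rho> (y-2)" using xA[OF that(1)] Az[OF that(1)] by blast
    moreover have "x z \<notin> \<rho> (y-2)" using new[of "y-2" "z-2"] that by (auto simp: x_def)
    ultimately show ?thesis by metis
  qed
  define \<sigma> where "\<sigma> = (\<lambda>z. {x z})"
  define \<eta> where "\<eta> = (\<lambda>z. \<rho> (z-1))"
  have xl: "x z \<in> \<rho> (z-1)" if "z \<in> {1..k+1}" for z
  proof (cases "z = 1")
    case False
    then have "z \<in> {2..k+1}" using that by auto
    then show ?thesis using xA Az(2) by blast
  qed (use u(1) in \<open>simp add: x_def\<close>)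
  have xr: "x (z+1) \<in> \<rho> (z-1)" if "z \<in> {1..k+1}" for z
  proof (cases "z = k + 1")
    case False
    then have "z + 1 \<in> {2..k+1}" "z + 1 - 2 = z - 1" using that by auto
    then show ?thesis using xA[of "z+1"] Az(1)[of "z+1"] by auto
  qed (use u(2) in \<open>simp add: x_def\<close>)
  have vert: "{y} \<in> simplices 0 K" if "y \<in> \<rho> j" "j \<le> k" for y j
    using pure_complex_face[OF pure, of "\<rho> j" "{y}"] \<rho>[OF that(2)] that(1)
    by (auto simp: simplices_def)
  have walk: "walk_seq K 0 n (k+1) \<sigma> \<eta>"
    unfolding walk_seq_def
  proof (intro conjI ballI)
    fix z assume z: "z \<in> {1..k+1+1}"
    show "\<sigma> z \<in> simplices 0 K"
    proof (cases "z = k + 2")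
      case True
      then show ?thesis using vert[of u k] u(2) by (simp add: \<sigma>_def x_def)
    next
      case False
      then show ?thesis using vert[of "x z" "z-1"] xl[of z] z by (auto simp: \<sigma>_def)
    qed
  next
    fix z assume z: "z \<in> {1..k+1}"
    show "\<eta> z \<in> simplices n K" using \<rho> z by (auto simp: \<eta>_def)
    have "x z \<noteq> x (z+1)"
    proof -
      consider "z = 1" | "z = k + 1" | "z \<in> {2..k}" using z by force
      then show ?thesis
        by cases (use x_u[of 2] x_u[of "k+1"] x_neq[of z "z+1"] k2 in \<open>auto simp: x_def\<close>)
    qed
    then show "\<sigma> z \<noteq> \<sigma> (z+1)" by (simp add: \<sigma>_def)
    show "is_face (\<sigma> z) (\<eta> z)" "is_face (\<sigma> (z+1)) (\<eta> z)"
      using xl[OF z] xr[OF z] by (auto simp: is_face_def \<sigma>_def \<eta>_def)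
  qed simp
  have "inj_on \<sigma> {1..k+1}"
  proof (rule linorder_inj_onI)
    fix y z assume yz: "y < z" "y \<in> {1..k+1}" "z \<in> {1..k+1}"
    then show "\<sigma> y \<noteq> \<sigma> z"
      using x_u[of z] x_neq[of y z] by (cases "y = 1") (auto simp: \<sigma>_def x_def)
  qed auto
  moreover have "inj_on \<eta> {1..k+1}"
    unfolding \<eta>_def
  proof (rule linorder_inj_onI)
    fix y z assume "y < z" "y \<in> {1..k+1}" "z \<in> {1..k+1}"
    then have "y - 1 < z - 1" "z - 1 \<le> k" by auto
    then show "\<rho> (y-1) \<noteq> \<rho> (z-1)" using \<rho>_neq[of "y-1" "z-1"] by auto
  qed auto
  ultimately have circ: "circuit_seq K 0 n (k+1) \<sigma> \<eta>"
    unfolding circuit_seq_def using walk by (auto simp: \<sigma>_def x_def)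
  \<comment> \<open>These are the interior members \<open>\<rho> 1\<close> to
    \<open>\<rho> (k-1)\<close> of the loop, which avoid \<open>u\<close>.\<close>
  have "\<not> is_face (\<sigma> 1) (\<eta> z)" if "z \<in> {2..k+1-1}" for z
  proof -
    have "0 < z - 1" "z - 1 < k" using that by auto
    then show ?thesis using u(4) by (simp add: is_face_def \<sigma>_def x_def \<eta>_def)
  qed
  moreover have "A (z-1) \<in> simplices (n-1) K \<and> is_face (A (z-1)) (\<eta> (z-1)) \<and>
      is_face (A (z-1)) (\<eta> z) \<and> is_face (\<sigma> z) (A (z-1))" if "z \<in> {2..k+1}" for z
  proof -
    have z: "z - 1 \<in> {1..k}" using that by auto
    have ne: "A (z-1) \<noteq> {}" using xA[OF that] by auto
    then have "A (z-1) \<in> K"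
      using pure_complex_face[OF pure, of "\<rho> (z-1)"] \<rho>[of "z-1"] A[OF z] z
      by (auto simp: simplices_def)
    then show ?thesis using ne A[OF z] xA[OF that] n
      by (auto simp: simplices_def is_face_def \<sigma>_def \<eta>_def)
  qed
  moreover have "inj_on (\<lambda>z. A (z-1)) {2..k+1}"
  proof (rule linorder_inj_onI)
    fix y z assume "y < z" "y \<in> {2..k+1}" "z \<in> {2..k+1}"
    then have "1 \<le> y - 1" "y - 1 < z - 1" "z - 1 \<le> k" by auto
    then show "A (y-1) \<noteq> A (z-1)" using A_neq[of "y-1" "z-1"] by auto
  qed auto
  ultimately have "simplicial_cycle_seq K 0 n (k+1) \<sigma> \<eta>"
    unfolding simplicial_cycle_seq_def using circ k2
    by (intro conjI exI[of _ "\<lambda>z. A (z-1)"]) auto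
  moreover have "0 < n" using n by simp
  ultimately show ?thesis unfolding acyclic_complex_def by blast
qed

section \<open>Trees have complete orderings\<close>

text \<open>Both simplices are taken from \<open>L\<close>, so that reachability means a chain
  staying among the simplices already listed.\<close>

definition facet_adj :: "nat \<Rightarrow> 'a set set \<Rightarrow> ('a set \<times> 'a set) set" where
  "facet_adj n L = {(\<theta>, \<theta>'). \<theta> \<in> L \<and> \<theta>' \<in> L \<and> (\<exists>A. card A = n \<and> A \<subseteq> \<theta> \<and> A \<subseteq> \<theta>')}"

text \<open>A common vertex \<open>u\<close> outside \<open>W\<close> would give a facet loop: start
  at \<open>\<eta>\<close>, cross \<open>W\<close> into \<open>\<theta>0\<close>, and follow a chain
  inside \<open>L\<close> until \<open>u\<close> reappears.\<close>

lemma acyclic_attaching_face: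
  assumes pure: "pure_complex V n K" and n: "1 \<le> n" and acyc: "acyclic_complex n K"
    and L: "L \<subseteq> simplices n K" "L \<times> L \<subseteq> (facet_adj n L)\<^sup>*"
    and \<eta>: "\<eta> \<in> simplices n K" "\<eta> \<notin> L"
    and W: "card W = n" "W \<subseteq> \<eta>" "\<theta>0 \<in> L" "W \<subseteq> \<theta>0" and \<theta>: "\<theta> \<in> L"
  shows "\<eta> \<inter> \<theta> \<subseteq> W"
proof (rule ccontr)
  assume "\<not> \<eta> \<inter> \<theta> \<subseteq> W"
  then obtain u where u: "u \<in> \<eta>" "u \<in> \<theta>" "u \<notin> W" by blast
  have fin: "finite \<zeta>" "card \<zeta> = n + 1" if "\<zeta> \<in> simplices n K" for \<zeta>
    using that pure_complex_finite_simplex[OF pure] by (auto simp: simplices_def)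
  have "(\<theta>0, \<theta>) \<in> (facet_adj n L)\<^sup>*" using L(2) W(3) \<theta> by blast
  then obtain m where "(\<theta>0, \<theta>) \<in> facet_adj n L ^^ m" using rtrancl_imp_relpow by blast
  then obtain f where f: "f 0 = \<theta>0" "f m = \<theta>" "\<And>i. i < m \<Longrightarrow> (f i, f (Suc i)) \<in> facet_adj n L"
    by (auto simp: relpow_fun_conv)
  \<comment> \<open>Stopping at the first member containing \<open>u\<close> keeps \<open>u\<close>
    out of the interior of the loop.\<close>
  define p where "p = (LEAST p. u \<in> f p)"
  have p: "u \<in> f p" "p \<le> m" and before: "\<And>i. i < p \<Longrightarrow> u \<notin> f i"
    unfolding p_def
    by (rule LeastI[of _ m], use u f in simp, rule Least_le, use u f in simp, rule not_less_Least)
  \<comment> \<open>Otherwise \<open>\<theta>0\<close> and \<open>\<eta>\<close> would both be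
    \<open>W\<close> together with \<open>u\<close>. Hence \<open>p\<close> is positive and the loop
    has length at least 2.\<close>
  have "u \<notin> \<theta>0"
  proof
    assume "u \<in> \<theta>0"
    moreover have "\<theta>0 \<in> simplices n K" using W(3) L(1) by blast
    ultimately have "\<theta>0 = insert u W" "\<eta> = insert u W"
      using insert_eq_of_card[OF W(4,1) fin _ u(3)] insert_eq_of_card[OF W(2,1) fin[OF \<eta>(1)] u(1,3)]
      by blast+
    then show False using \<eta>(2) W(3) by simp
  qed
  then have p1: "1 \<le> p" using p(1) f(1) by (cases p) auto
  have fL: "f i \<in> L" if "i \<le> m" for i
    using f(3)[of "i-1"] f(1) W(3) that by (cases i) (auto simp: facet_adj_def)
  have "\<forall>i. \<exists>B. i < m \<longrightarrow> card B = n \<and> B \<subseteq> f i \<and> B \<subseteq> f (Suc i)"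
    using f(3) unfolding facet_adj_def by blast
  then obtain B where B: "\<And>i. i < m \<Longrightarrow> card (B i) = n \<and> B i \<subseteq> f i \<and> B i \<subseteq> f (Suc i)" by metis
  define \<rho> where "\<rho> = (\<lambda>t. case t of 0 \<Rightarrow> \<eta> | Suc i \<Rightarrow> f i)"
  define A where "A = (\<lambda>t. case t - 1 of 0 \<Rightarrow> W | Suc i \<Rightarrow> B i)"
  have "facet_loop n (simplices n K) (Suc p) \<rho> A u"
    unfolding facet_loop_def
  proof (intro conjI allI impI ballI)
    fix j assume "j \<le> Suc p"
    then show "\<rho> j \<in> simplices n K" using \<eta>(1) fL p(2) L(1) by (auto simp: \<rho>_def split: nat.split)
  next
    fix j assume "j \<in> {1..Suc p}"
    then have "j = 1 \<or> j = Suc (Suc (j - 2)) \<and> j - 2 < p" by auto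
    then consider "j = 1" | i where "j = Suc (Suc i)" "i < p" by blast
    then have "A j \<subseteq> \<rho> (j-1) \<and> A j \<subseteq> \<rho> j \<and> card (A j) = n"
      by cases (use W f(1) B p(2) in \<open>auto simp: \<rho>_def A_def\<close>)
    then show "A j \<subseteq> \<rho> (j-1)" "A j \<subseteq> \<rho> j" "card (A j) = n" by auto
  next
    fix j assume "j \<in> {0<..<Suc p}"
    then show "u \<notin> \<rho> j" using before by (cases j) (auto simp: \<rho>_def)
  qed (use p1 u p fL \<eta>(2) in \<open>auto simp: \<rho>_def\<close>)
  then show False using facet_loop_imp_cycle[OF pure n] acyc by blast
qed

section \<open>Growing the ordering of a tree\<close>

text \<open>Take a path from a face of a member of \<open>L\<close> to a face of a non-member.
  Without a face shared across the boundary, every n-simplex on the path would belong to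
  \<open>L\<close>.\<close>

lemma connected_boundary_face:
  assumes pure: "pure_complex V n K" and n: "1 \<le> n" and conn: "connected_complex n K"
    and L: "L \<subseteq> simplices n K" "L \<noteq> {}" "L \<noteq> simplices n K"
  obtains \<theta> \<eta> W where "\<theta> \<in> L" "\<eta> \<in> simplices n K" "\<eta> \<notin> L" "card W = n" "W \<subseteq> \<theta>" "W \<subseteq> \<eta>"
proof -
  obtain \<theta> \<eta> where \<theta>: "\<theta> \<in> L" and \<eta>: "\<eta> \<in> simplices n K" "\<eta> \<notin> L" using L by blast
  have ex: "\<exists>\<tau>\<in>simplices (n-1) K. \<tau> \<subseteq> \<zeta>" if "\<zeta> \<in> simplices n K" for \<zeta>
  proof -
    have "n \<le> card \<zeta>" using that by (simp add: simplices_def)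
    then obtain \<tau> where \<tau>: "\<tau> \<subseteq> \<zeta>" "card \<tau> = n" by (meson obtain_subset_with_card_n)
    then have "\<tau> \<noteq> {}" using n by auto
    then show ?thesis using \<tau> n pure_complex_face[OF pure, of \<zeta> \<tau>] that
      by (auto simp: simplices_def)
  qed
  obtain \<tau> \<tau>' where \<tau>: "\<tau> \<in> simplices (n-1) K" "\<tau> \<subseteq> \<theta>" and \<tau>': "\<tau>' \<in> simplices (n-1) K" "\<tau>' \<subseteq> \<eta>"
    using ex \<theta> \<eta> L(1) by blast
  have card: "card \<sigma> = n" if "\<sigma> \<in> simplices (n-1) K" for \<sigma>
    using that n by (simp add: simplices_def)
  show thesis
  proof (rule ccontr)
    assume "\<not> thesis"
    then have no: False if "\<sigma> \<in> simplices (n-1) K" "\<zeta> \<in> L" "\<sigma> \<subseteq> \<zeta>" "\<xi> \<in> simplices n K" "\<xi> \<notin> L" "\<sigma> \<subseteq> \<xi>"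
      for \<sigma> \<zeta> \<xi>
      using that(1-6) \<open>\<And>\<theta> \<eta> W. \<lbrakk>\<theta> \<in> L; \<eta> \<in> simplices n K; \<eta> \<notin> L; card W = n; W \<subseteq> \<theta>; W \<subseteq> \<eta>\<rbrakk> \<Longrightarrow> thesis\<close> card
      by blast
    \<comment> \<open>Connectedness provides paths only between distinct simplices; a common
      \<open>\<tau>\<close> would itself be the desired face.\<close>
    have "\<tau> \<noteq> \<tau>'" using no[of \<tau> \<theta> \<eta>] \<tau> \<tau>' \<theta> \<eta> by blast
    then obtain r \<sigma> \<xi> where path: "path_seq K (n-1) n r \<sigma> \<xi>" and ends: "\<sigma> 1 = \<tau>" "\<sigma> (r+1) = \<tau>'"
      using conn \<tau>(1) \<tau>'(1) unfolding connected_complex_def by blast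
    have s: "\<And>k. k \<in> {1..r+1} \<Longrightarrow> \<sigma> k \<in> simplices (n-1) K"
      and x: "\<And>k. k \<in> {1..r} \<Longrightarrow> \<xi> k \<in> simplices n K \<and> \<sigma> k \<subseteq> \<xi> k \<and> \<sigma> (k+1) \<subseteq> \<xi> k"
      using path unfolding path_seq_def walk_seq_def is_face_def by blast+
    have "\<exists>\<zeta>\<in>L. \<sigma> (Suc k) \<subseteq> \<zeta>" if "k \<le> r" for k
      using that
    proof (induction k)
      case 0
      then show ?case using ends \<tau> \<theta> by auto
    next
      case (Suc k)
      then obtain \<zeta> where z: "\<zeta> \<in> L" "\<sigma> (Suc k) \<subseteq> \<zeta>" by auto
      have "\<xi> (Suc k) \<in> L" using no[of "\<sigma> (Suc k)" \<zeta> "\<xi> (Suc k)"] z s[of "Suc k"] x[of "Suc k"] Suc.prems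
        by auto
      then show ?case using x[of "Suc k"] Suc.prems by auto
    qed
    then obtain \<zeta> where "\<zeta> \<in> L" "\<tau>' \<subseteq> \<zeta>" using ends by auto
    then show False using no[of \<tau>' \<zeta> \<eta>] \<tau>' \<eta> by blast
  qed
qed

text \<open>\<open>\<theta>\<close> acts as a hub: every member of the enlarged set reaches it and
  is reached from it.\<close>

lemma facet_adj_insert:
  assumes L: "L \<times> L \<subseteq> (facet_adj n L)\<^sup>*" and "\<theta> \<in> L" "card W = n" "W \<subseteq> \<theta>" "W \<subseteq> \<eta>"
  shows "insert \<eta> L \<times> insert \<eta> L \<subseteq> (facet_adj n (insert \<eta> L))\<^sup>*"
proof -
  let ?R = "facet_adj n (insert \<eta> L)"
  have "facet_adj n L \<subseteq> ?R" by (auto simp: facet_adj_def)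
  then have old: "L \<times> L \<subseteq> ?R\<^sup>*" using L rtrancl_mono by blast
  have new: "(\<theta>, \<eta>) \<in> ?R" "(\<eta>, \<theta>) \<in> ?R" using assms(2-5) by (auto simp: facet_adj_def)
  have "(\<theta>, \<zeta>) \<in> ?R\<^sup>* \<and> (\<zeta>, \<theta>) \<in> ?R\<^sup>*" if "\<zeta> \<in> insert \<eta> L" for \<zeta>
    using that old new assms(2) by auto
  then show ?thesis by (auto intro: rtrancl_trans)
qed

text \<open>Induction on the number of listed simplices. Mutual reachability is carried along
  because \<open>acyclic_attaching_face\<close> needs chains within the listed set.\<close>

lemma tree_partial_ordering:
  assumes pure: "pure_complex V n K" and n: "1 \<le> n"
    and conn: "connected_complex n K" and acyc: "acyclic_complex n K"
    and "t \<le> card (simplices n K)"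
  shows "\<exists>\<eta>. inj_on \<eta> {1..t} \<and> \<eta> ` {1..t} \<subseteq> simplices n K \<and>
     \<eta> ` {1..t} \<times> \<eta> ` {1..t} \<subseteq> (facet_adj n (\<eta> ` {1..t}))\<^sup>* \<and>
     (\<forall>i\<in>{2..t}. \<exists>W. card W = n \<and> W \<subseteq> \<eta> i \<and> (\<exists>j\<in>{1..<i}. W \<subseteq> \<eta> j) \<and> (\<forall>j\<in>{1..<i}. \<eta> i \<inter> \<eta> j \<subseteq> W))"
  using assms(5)
proof (induction t)
  case 0
  then show ?case by auto
next
  case (Suc t)
  then obtain \<eta> where inj: "inj_on \<eta> {1..t}" and im: "\<eta> ` {1..t} \<subseteq> simplices n K"
    and adj: "\<eta> ` {1..t} \<times> \<eta> ` {1..t} \<subseteq> (facet_adj n (\<eta> ` {1..t}))\<^sup>*"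
    and W: "\<forall>i\<in>{2..t}. \<exists>W. card W = n \<and> W \<subseteq> \<eta> i \<and> (\<exists>j\<in>{1..<i}. W \<subseteq> \<eta> j) \<and>
              (\<forall>j\<in>{1..<i}. \<eta> i \<inter> \<eta> j \<subseteq> W)"
    by auto
  show ?case
  proof (cases "t = 0")
    case True
    obtain \<zeta> where "\<zeta> \<in> simplices n K" using pure_complex_facets_nonempty[OF pure] by blast
    then show ?thesis using True by (intro exI[of _ "\<lambda>_. \<zeta>"]) auto
  next
    case False
    let ?L = "\<eta> ` {1..t}"
    have "card ?L = t" using inj by (simp add: card_image)
    \<comment> \<open>Fewer n-simplices are listed than exist, so a boundary face \<open>W'\<close>
      leads to a new one \<open>\<zeta>\<close>.\<close>
    then have "?L \<noteq> simplices n K" using Suc.prems by auto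
    then obtain \<theta> \<zeta> W' where z: "\<theta> \<in> ?L" "\<zeta> \<in> simplices n K" "\<zeta> \<notin> ?L" "card W' = n" "W' \<subseteq> \<theta>" "W' \<subseteq> \<zeta>"
      by (rule connected_boundary_face[OF pure n conn im, rotated]) (use False in auto)
    have meet: "\<zeta> \<inter> \<eta> j \<subseteq> W'" if "j \<in> {1..t}" for j
      using acyclic_attaching_face[OF pure n acyc im adj z(2,3,4,6,1,5)] that by blast
    define \<eta>' where "\<eta>' = \<eta>(Suc t := \<zeta>)"
    have old: "\<eta>' j = \<eta> j" if "j \<le> t" for j using that by (simp add: \<eta>'_def)
    have im_old: "\<eta>' ` {1..t} = ?L" by (intro image_cong) (auto simp: old)
    have dom: "{1..Suc t} = insert (Suc t) {1..t}" by auto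
    have im': "\<eta>' ` {1..Suc t} = insert \<zeta> ?L" unfolding dom image_insert im_old by (simp add: \<eta>'_def)
    have "inj_on \<eta>' {1..t}" using inj by (rule inj_on_cong[THEN iffD1, rotated]) (simp add: old)
    then have "inj_on \<eta>' {1..Suc t}"
      unfolding dom using im_old z(3) by (auto simp: inj_on_insert \<eta>'_def)
    moreover have "\<exists>U. card U = n \<and> U \<subseteq> \<eta>' i \<and> (\<exists>j\<in>{1..<i}. U \<subseteq> \<eta>' j) \<and> (\<forall>j\<in>{1..<i}. \<eta>' i \<inter> \<eta>' j \<subseteq> U)"
      if i: "i \<in> {2..Suc t}" for i
    proof (cases "i = Suc t")
      case True
      obtain j where "j \<in> {1..t}" "\<theta> = \<eta> j" using z(1) by blast
      then have "\<exists>j\<in>{1..<i}. W' \<subseteq> \<eta>' j" using z(5) True old by (intro bexI[of _ j]) auto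
      moreover have "\<forall>j\<in>{1..<i}. \<eta>' i \<inter> \<eta>' j \<subseteq> W'" using meet True by (auto simp: \<eta>'_def)
      moreover have "\<eta>' i = \<zeta>" using True by (simp add: \<eta>'_def)
      ultimately show ?thesis using z(4,6) by blast
    next
      case False
      then have "\<eta>' i = \<eta> i" "\<forall>j\<in>{1..<i}. \<eta>' j = \<eta> j" "i \<in> {2..t}" using i old by auto
      then show ?thesis using W by (metis (no_types, lifting))
    qed
    ultimately show ?thesis
      using im z(2) facet_adj_insert[OF adj z(1,4,5,6)] unfolding im'[symmetric]
      by (intro exI[of _ \<eta>'] conjI ballI) (auto simp only: im' insert_subset)
  qed
qed

theorem theorem5p2:
  fixes V :: "'a set" and K :: "'a set set" and n :: nat
  assumes "1 \<le> n" and "pure_complex V n K"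
  shows "simplicial_tree V n K \<longleftrightarrow> has_complete_ordering n K"
proof -
  let ?t = "card (simplices n K)"
  have fin: "finite \<zeta>" "card \<zeta> = n + 1" if "\<zeta> \<in> simplices n K" for \<zeta>
    using that pure_complex_finite_simplex[OF assms(2)] by (auto simp: simplices_def)
  have step: "complete_complex_on n (attachment n (\<eta> i) (simplex_closure (\<eta> ` {1..i}))) \<longleftrightarrow>
      (\<exists>W. card W = n \<and> W \<subseteq> \<eta> i \<and> (\<exists>j\<in>{1..<i}. W \<subseteq> \<eta> j) \<and> (\<forall>j\<in>{1..<i}. \<eta> i \<inter> \<eta> j \<subseteq> W))"
    if "bij_betw \<eta> {1..?t} (simplices n K)" "i \<in> {2..?t}" for \<eta> i
    by (rule complete_attachment_step_iff[OF _ that(2) assms(1)])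
      (use that(1) fin bij_betwE[OF that(1)] in \<open>auto simp: bij_betw_def\<close>)
  show ?thesis
  proof
    assume "simplicial_tree V n K"
    then have "connected_complex n K" "acyclic_complex n K" by (simp_all add: simplicial_tree_def)
    from tree_partial_ordering[OF assms(2,1) this order_refl]
    obtain \<eta> where \<eta>: "inj_on \<eta> {1..?t}" "\<eta> ` {1..?t} \<subseteq> simplices n K"
      and W: "\<forall>i\<in>{2..?t}. \<exists>W. card W = n \<and> W \<subseteq> \<eta> i \<and> (\<exists>j\<in>{1..<i}. W \<subseteq> \<eta> j) \<and>
                (\<forall>j\<in>{1..<i}. \<eta> i \<inter> \<eta> j \<subseteq> W)"
      by (elim exE conjE) (rule that)
    \<comment> \<open>Finiteness makes the injective list of full length exhaust all
      n-simplices.\<close>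
    have "finite (simplices n K)"
      using pure_complex_finite[OF assms(2)] by (simp add: simplices_def)
    moreover have "card (\<eta> ` {1..?t}) = ?t" using \<eta>(1) by (simp add: card_image)
    ultimately have "\<eta> ` {1..?t} = simplices n K" using \<eta>(2) by (simp add: card_subset_eq)
    then have bij: "bij_betw \<eta> {1..?t} (simplices n K)" using \<eta>(1) by (simp add: bij_betw_def)
    have "complete_complex_on n (attachment n (\<eta> i) (simplex_closure (\<eta> ` {1..i})))"
      if "i \<in> {2..?t}" for i
      unfolding step[OF bij that] using W that by (rule bspec)
    with bij show "has_complete_ordering n K"
      unfolding has_complete_ordering_def by blast
  next
    assume "has_complete_ordering n K"
    then obtain \<eta> where bij: "bij_betw \<eta> {1..?t} (simplices n K)"
      and compl: "\<forall>i\<in>{2..?t}. complete_complex_on n (attachment n (\<eta> i) (simplex_closure (\<eta> ` {1..i})))"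
      unfolding has_complete_ordering_def by (elim exE conjE) (rule that)
    have "\<forall>i\<in>{2..?t}. \<exists>W. card W = n \<and> W \<subseteq> \<eta> i \<and> (\<exists>j\<in>{1..<i}. W \<subseteq> \<eta> j) \<and>
             (\<forall>j\<in>{1..<i}. \<eta> i \<inter> \<eta> j \<subseteq> W)"
      using compl step[OF bij] by blast
    from bchoice[OF this] obtain W where W: "\<And>i. i \<in> {2..?t} \<Longrightarrow> card (W i) = n \<and> W i \<subseteq> \<eta> i \<and>
        (\<exists>j\<in>{1..<i}. W i \<subseteq> \<eta> j) \<and> (\<forall>j\<in>{1..<i}. \<eta> i \<inter> \<eta> j \<subseteq> W i)"
      by blast
    have "connected_complex n K"
      by (rule complete_ordering_connected[OF assms(2,1) bij, of W]) (use W in blast)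
    moreover have "acyclic_complex n K"
      by (rule complete_ordering_acyclic[OF bij assms(1), of W])
        (use W in blast)
    ultimately show "simplicial_tree V n K" using assms(2) by (simp add: simplicial_tree_def)
  qed
qed

end
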